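(* Let $s$ and $L \ge s+1$ be positive integers. Write $H_{L,s,L}(q) = \sum_{n\ge 0} a_{L,n} q^n$, and set $\eta_1(L,s) = \sum_{n<\Gamma(s)} |a_{L,n}|$, $\eta_2(L,s) = \max(\eta_1(L,s),\Gamma(s))$, $\eta_3(L,s) = (L+1)\eta_2(L,s)$. Then the coefficient of $q^n$ in $G_{L,s}(q)$ is nonnegative for every integer $n \ge \eta_3(L,s)$.
   Context: $(a;q)_n := (1-a)(1-aq)\cdots(1-aq^{n-1})$. A partition $\pi$ is a finite weakly decreasing sequence of positive integers; $|\pi|$ is the sum of its parts, $s(\pi)$ its smallest part and $l(\pi)$ its largest part. For positive integers $L,s$, $$G_{L,s}(q) := \sum_{\substack{\pi \text{ nonempty},\ s(\pi)=s,\\ l(\pi)-s(\pi)\le L}} q^{|\pi|} \;-\; \sum_{\substack{\pi \text{ nonempty},\ s(\pi)\ge s+1,\\ l(\pi)-s(\pi)\le L}} q^{|\pi|},$$ and for positive integers $L,s,k$, $H_{L,s,k}(q) := \frac{q^s(1-q^k)}{(q^s;q)_{L+1}} - \left(\frac{1}{(q^{s+1};q)_L}-1\right)$. Let $P_{L,s} = (s+1)(s+2)\cdots(s+L)$, $$\gamma(L,s) = \big((s+1)+\cdots+(s+L)\big)\cdot\Big(P_{L,s}^{(P_{L,s}^2-1)L+2} + \big((P_{L,s}^2-1)L-2\big)P_{L,s}\Big),$$ and $\Gamma(s) = \gamma(3s+2,s)$. *)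

theory Defs
  imports Complex_Main "HOL-Computational_Algebra.Formal_Power_Series"
begin

definition qpoch :: "'a::comm_ring_1 \<Rightarrow> 'a \<Rightarrow> nat \<Rightarrow> 'a" where
  "qpoch a q n = (\<Prod>i<n. 1 - a * q ^ i)"

definition is_partition :: "nat list \<Rightarrow> bool" where
  "is_partition p \<longleftrightarrow> sorted_wrt (\<ge>) p \<and> (\<forall>x\<in>set p. 0 < x)"

definition smallest_part :: "nat list \<Rightarrow> nat" where
  "smallest_part p = Min (set p)"

definition largest_part :: "nat list \<Rightarrow> nat" where
  "largest_part p = Max (set p)"

(* A family of partitions has finitely many members of each size
   (finite_partitions_of_size), so the coefficients below are genuine
   cardinalities and the series is the formal sum of q^|p| over p in A. *)
definition size_gf :: "nat list set \<Rightarrow> real fps" where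
  "size_gf A = Abs_fps (\<lambda>n. real (card {p \<in> A. sum_list p = n}))"

lemma finite_partitions_of_size: "finite {p. is_partition p \<and> sum_list p = n}"
proof (rule finite_subset)
  have len: "length p \<le> sum_list p" if "\<forall>x\<in>set p. 0 < x" for p :: "nat list"
    using that by (induction p) auto
  show "{p. is_partition p \<and> sum_list p = n} \<subseteq> {p. set p \<subseteq> {..n} \<and> length p \<le> n}"
    by (auto simp: is_partition_def intro: len member_le_sum_list)
  show "finite {p :: nat list. set p \<subseteq> {..n} \<and> length p \<le> n}"
    by (rule finite_lists_length_le) simp
qed

definition G :: "nat \<Rightarrow> nat \<Rightarrow> real fps" where
  "G L s =
     size_gf {p. is_partition p \<and> p \<noteq> [] \<and> smallest_part p = s \<and>
                 largest_part p - smallest_part p \<le> L} -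
     size_gf {p. is_partition p \<and> p \<noteq> [] \<and> s + 1 \<le> smallest_part p \<and>
                 largest_part p - smallest_part p \<le> L}"

(* For s > 0 both denominators have constant term 1, so the divisions are
   exact in the ring of formal power series. *)
definition H :: "nat \<Rightarrow> nat \<Rightarrow> nat \<Rightarrow> real fps" where
  "H L s k =
     fps_X ^ s * (1 - fps_X ^ k) / qpoch (fps_X ^ s) fps_X (L + 1) -
     (1 / qpoch (fps_X ^ (s + 1)) fps_X L - 1)"

definition P :: "nat \<Rightarrow> nat \<Rightarrow> nat" where
  "P L s = (\<Prod>i=1..L. s + i)"

(* For L, s > 0 we have P L s \<ge> 2, so neither subtraction is truncated. *)
definition gam :: "nat \<Rightarrow> nat \<Rightarrow> nat" where
  "gam L s = (\<Sum>i=1..L. s + i) *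
     (P L s ^ (((P L s)^2 - 1) * L + 2) + (((P L s)^2 - 1) * L - 2) * P L s)"

definition Gam :: "nat \<Rightarrow> nat" where
  "Gam s = gam (3 * s + 2) s"

definition eta1 :: "nat \<Rightarrow> nat \<Rightarrow> real" where
  "eta1 L s = (\<Sum>n<Gam s. \<bar>fps_nth (H L s L) n\<bar>)"

definition eta2 :: "nat \<Rightarrow> nat \<Rightarrow> real" where
  "eta2 L s = max (eta1 L s) (real (Gam s))"

definition eta3 :: "nat \<Rightarrow> nat \<Rightarrow> real" where
  "eta3 L s = (real L + 1) * eta2 L s"

end

theory Submission
  imports Defs "HOL-Library.Multiset"
begin

(* Let E(k) count the partitions of k into parts from {s+1..s+L}.  Splitting off the parts equal to s, and
   telescoping over the smallest part, reduces the claim to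
     sum_{j >= 0} E(n - jL) <= sum_{i >= 1} E(n - is).
   Adding parts shows E(k - d) <= E(k) for every d >= s+1, so almost every term on the left is dominated by
   its own term on the right, with infinitely many i to spare.  One or three copies of E(n) are left over.
   Partitions of n with m*s copies of some part p inject into those of n - (m*p)*s, so a spare i = m*p
   accounts for them.  If L is small compared with s, then every partition of n is of this kind.  If L is
   large, the others have many distinct parts, and lowering one of these by s or by 4s accounts for them by
   double counting. *)

section \<open>Partitions as multisets of parts\<close>

declare of_nat_sum_mset [simp del]

(* The sum is an integer so that shifts below zero need no side conditions: msets S k is empty for k < 0. *)
definition msets :: "nat set \<Rightarrow> int \<Rightarrow> nat multiset set" where
  "msets S k = {M. set_mset M \<subseteq> S \<and> int (sum_mset M) = k}"

definition npart :: "nat set \<Rightarrow> int \<Rightarrow> nat" where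
  "npart S k = card (msets S k)"

text \<open>A partition is the reversal of its sorted list, and sorting depends only on the
  multiset.\<close>

lemma is_partition_mset_inj: "inj_on mset {p. is_partition p}"
proof (rule inj_onI)
  fix p q assume pq: "p \<in> {p. is_partition p}" "q \<in> {p. is_partition p}" "mset p = mset q"
  have *: "rev r = sort r" if "is_partition r" for r
  proof (rule properties_for_sort[symmetric])
    show "sorted (rev r)" using that by (simp add: is_partition_def sorted_wrt_rev)
  qed simp
  have "sort p = sort q" using pq(3) by (intro properties_for_sort) simp_all
  then show "p = q" using * pq by (metis mem_Collect_eq rev_rev_ident)
qed

lemma card_partitions_mset:
  assumes "\<And>p. Q p \<longleftrightarrow> R (mset p)"
  shows "card {p \<in> {p. is_partition p \<and> Q p}. sum_list p = n} =
    card {M. 0 \<notin># M \<and> R M \<and> sum_mset M = n}"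
proof -
  let ?A = "{p \<in> {p. is_partition p \<and> Q p}. sum_list p = n}"
  have "mset ` ?A = {M. 0 \<notin># M \<and> R M \<and> sum_mset M = n}"
  proof (intro equalityI subsetI)
    fix M assume M: "M \<in> {M. 0 \<notin># M \<and> R M \<and> sum_mset M = n}"
    let ?p = "rev (sorted_list_of_multiset M)"
    have "mset ?p = M" by simp
    moreover have "is_partition ?p"
      using M by (auto simp: is_partition_def sorted_wrt_rev intro: gr0I)
    moreover have "sum_list ?p = n" using M \<open>mset ?p = M\<close> by (metis (mono_tags, lifting) mem_Collect_eq sum_mset_sum_list)
    ultimately show "M \<in> mset ` ?A" using M assms by (intro image_eqI[where x = ?p]) auto
  qed (auto simp: is_partition_def assms sum_mset_sum_list)
  moreover have "inj_on mset ?A"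
    by (rule inj_on_subset[OF is_partition_mset_inj]) auto
  ultimately show ?thesis using card_image[of mset ?A] by simp
qed

lemma member_le_sum_mset: "x \<in># M \<Longrightarrow> x \<le> sum_mset M" for x :: nat
  by (auto dest!: multi_member_split)

lemma finite_msets:
  assumes "0 \<notin> S" shows "finite (msets S k)"
proof (rule finite_subset)
  have pos: "0 \<notin># M \<Longrightarrow> size M \<le> sum_mset M" for M :: "nat multiset"
    by (induction M) auto
  show "msets S k \<subseteq> mset ` {p. set p \<subseteq> {..nat k} \<and> length p \<le> nat k}"
  proof
    fix M assume M: "M \<in> msets S k"
    obtain p where p: "M = mset p" by (metis ex_mset)
    have sum: "sum_mset M = nat k" and "0 \<notin># M" using M assms by (auto simp: msets_def)
    have "set p \<subseteq> {..nat k}" using member_le_sum_mset[of _ M] sum p by auto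
    moreover have "length p \<le> nat k" using pos[OF \<open>0 \<notin># M\<close>] sum p by simp
    ultimately show "M \<in> mset ` {p. set p \<subseteq> {..nat k} \<and> length p \<le> nat k}" using p by blast
  qed
  show "finite (mset ` {p :: nat list. set p \<subseteq> {..nat k} \<and> length p \<le> nat k})"
    by (intro finite_imageI finite_lists_length_le) simp
qed

section \<open>Recurrence and monotonicity of the counts\<close>

lemma npart_neg: "k < 0 \<Longrightarrow> npart S k = 0"
  by (auto simp: npart_def msets_def)

text \<open>Removing \<open>m\<close> copies of \<open>p\<close> is a bijection; when
  \<open>m * p\<close> exceeds \<open>k\<close>, both sides are 0.\<close>

lemma card_msets_with:
  assumes "p \<in> S"
  shows "card {M \<in> msets S k. replicate_mset m p \<subseteq># M} = npart S (k - int m * int p)"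
proof -
  have "bij_betw (\<lambda>M. M + replicate_mset m p) (msets S (k - int m * int p))
      {M \<in> msets S k. replicate_mset m p \<subseteq># M}"
  proof (rule bij_betw_byWitness[where f' = "\<lambda>M. M - replicate_mset m p"])
    show "(\<lambda>M. M - replicate_mset m p) ` {M \<in> msets S k. replicate_mset m p \<subseteq># M}
        \<subseteq> msets S (k - int m * int p)"
    proof clarify
      fix M assume M: "M \<in> msets S k" "replicate_mset m p \<subseteq># M"
      then obtain M' where "M = replicate_mset m p + M'" by (auto simp: mset_subset_eq_exists_conv)
      then show "M - replicate_mset m p \<in> msets S (k - int m * int p)"
        using M(1) by (auto simp: msets_def sum_mset_replicate_mset)
    qed
    have "set_mset (replicate_mset m p) \<subseteq> S" using assms by simp
    then show "(\<lambda>M. M + replicate_mset m p) ` msets S (k - int m * int p)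
        \<subseteq> {M \<in> msets S k. replicate_mset m p \<subseteq># M}"
      by (clarsimp simp: msets_def sum_mset_replicate_mset)
  qed auto
  then show ?thesis by (simp add: npart_def bij_betw_same_card)
qed

text \<open>Either \<open>p\<close> does not occur, or one copy of it can be removed.\<close>

lemma npart_split:
  assumes "p \<in> S" "0 \<notin> S"
  shows "npart S k = npart (S - {p}) k + npart S (k - int p)"
proof -
  have eq: "msets S k = msets (S - {p}) k \<union> {M \<in> msets S k. replicate_mset 1 p \<subseteq># M}"
    by (auto simp: msets_def)
  have "npart S k = card (msets (S - {p}) k) + card {M \<in> msets S k. replicate_mset 1 p \<subseteq># M}"
    unfolding npart_def
    by (subst eq, rule card_Un_disjoint)
       (use finite_msets[OF assms(2)] finite_msets[of "S - {p}"] assms in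
        \<open>auto simp: msets_def intro: finite_subset[of _ "msets S k"]\<close>)
  then show ?thesis using card_msets_with[OF assms(1), of k 1] by (simp add: npart_def)
qed

text \<open>Adding a fixed part is injective, and every \<open>d >= s + 1\<close> is a sum of parts
  from the window: if \<open>d > s + L\<close>, then \<open>L >= s + 1\<close> ensures that
  \<open>d - (s + 1)\<close> is still at least \<open>s + 1\<close>.\<close>

lemma npart_mono_add:
  assumes "s + 1 \<le> L" "int s + 1 \<le> d"
  shows "npart {s+1..s+L} (k - d) \<le> npart {s+1..s+L} k"
proof -
  have part: "npart {s+1..s+L} (k - int p) \<le> npart {s+1..s+L} k" if "s + 1 \<le> p" "p \<le> s + L" for p k
    using npart_split[of p "{s+1..s+L}" k] that by auto
  have "npart {s+1..s+L} (k - int p) \<le> npart {s+1..s+L} k" if "s + 1 \<le> p" for p k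
    using that
  proof (induction p arbitrary: k rule: less_induct)
    case (less p)
    show ?case
    proof (cases "p \<le> s + L")
      case False
      then have "npart {s+1..s+L} (k - int (s + 1) - int (p - (s + 1))) \<le> npart {s+1..s+L} (k - int (s + 1))"
        using assms by (intro less.IH) auto
      also have "\<dots> \<le> npart {s+1..s+L} k" using assms by (intro part) auto
      finally show ?thesis using False by (simp add: of_nat_diff algebra_simps)
    qed (use part less in auto)
  qed
  from this[of "nat d" k] assms show ?thesis by auto
qed

section \<open>Reduction to an inequality between counts\<close>

text \<open>Term \<open>i\<close> counts the multisets on the right with exactly
  \<open>i - 1\<close> parts equal to \<open>s\<close>. The free choice of \<open>I\<close> lets
  later arguments spend only selected indices.\<close>

lemma sum_npart_le_with_smallest:
  assumes "0 < s" "finite I" "0 \<notin> I"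
  shows "(\<Sum>i\<in>I. npart {s+1..s+L} (k - int i * int s)) \<le> npart {s..s+L} (k - int s)"
proof -
  have eq: "{s..s+L} - {s} = {s+1..s+L}" by auto
  have iter: "npart {s..s+L} k = (\<Sum>i<m. npart {s+1..s+L} (k - int i * int s)) + npart {s..s+L} (k - int m * int s)"
    for k m
  proof (induction m)
    case (Suc m)
    have "npart {s..s+L} (k - int m * int s) =
        npart {s+1..s+L} (k - int m * int s) + npart {s..s+L} (k - int m * int s - int s)"
      using npart_split[of s "{s..s+L}" "k - int m * int s"] assms by (simp add: eq)
    then show ?case using Suc by (simp add: algebra_simps)
  qed simp
  obtain m where m: "I \<subseteq> {1..m}"
  proof
    show "I \<subseteq> {1..Max I}" using assms by (auto intro!: Suc_leI gr0I)
  qed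
  have "(\<Sum>i\<in>I. npart {s+1..s+L} (k - int i * int s)) \<le> (\<Sum>i\<in>{1..m}. npart {s+1..s+L} (k - int i * int s))"
    using m by (intro sum_mono2) auto
  also have "\<dots> = (\<Sum>i<m. npart {s+1..s+L} (k - int s - int i * int s))"
    by (rule sum.reindex_bij_witness[where i = Suc and j = "\<lambda>i. i - 1"]) (auto simp: algebra_simps of_nat_diff)
  also have "\<dots> \<le> npart {s..s+L} (k - int s)" using iter[of "k - int s" m] by simp
  finally show ?thesis .
qed

(* The series of q^t / (q^t;q)_{L+1}, summed over t > s, telescopes after multiplication by 1 - q^L. *)
lemma sum_npart_windows_le:
  assumes "1 \<le> L" "s \<le> m"
  shows "(\<Sum>t\<in>{s+1..m}. npart {t..t+L} (int n - int t)) \<le> (\<Sum>j\<le>n. npart {s+1..s+L} (int n - int j * int L))"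
proof -
  define D where "D k = (\<Sum>t\<in>{s+1..m}. npart {t..t+L} (k - int t))" for k
  \<comment> \<open>In the induction step the window starting at \<open>Suc m\<close> is split once
    at its smallest and once at its largest element; equating the two expressions gives the new
    term.\<close>
  have tel: "(\<Sum>t\<in>{s+1..m}. npart {t..t+L} (k - int t)) + npart {m+1..m+L} k =
     npart {s+1..s+L} k + (\<Sum>t\<in>{s+1..m}. npart {t..t+L} (k - int L - int t))" for k
    using assms(2)
  proof (induction m rule: dec_induct)
    case (step m)
    have a: "{Suc m..Suc m+L} - {Suc m} = {Suc m+1..Suc m+L}" by auto
    have b: "{Suc m..Suc m+L} - {Suc m+L} = {m+1..m+L}" using assms(1) by auto
    have e: "k - int (Suc m+L) = k - int L - int (Suc m)" by simp
    have "npart {Suc m..Suc m+L} k = npart {Suc m+1..Suc m+L} k + npart {Suc m..Suc m+L} (k - int (Suc m))"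
      using npart_split[of "Suc m" "{Suc m..Suc m+L}" k] unfolding a by simp
    moreover have "npart {Suc m..Suc m+L} k = npart {m+1..m+L} k + npart {Suc m..Suc m+L} (k - int L - int (Suc m))"
      using npart_split[of "Suc m+L" "{Suc m..Suc m+L}" k] unfolding b e by simp
    moreover have sum_Suc: "(\<Sum>t\<in>{s+1..Suc m}. h t) = h (Suc m) + (\<Sum>t\<in>{s+1..m}. h t)" for h :: "nat \<Rightarrow> nat"
      using step by simp
    ultimately show ?case using step.IH unfolding sum_Suc by linarith
  qed simp
  have D: "D k \<le> npart {s+1..s+L} k + D (k - int L)" for k
    using tel[of k] unfolding D_def by linarith
  have "D (int n) \<le> (\<Sum>j<J. npart {s+1..s+L} (int n - int j * int L)) + D (int n - int J * int L)" for J
  proof (induction J)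
    case (Suc J)
    then show ?case using D[of "int n - int J * int L"] by (simp add: algebra_simps)
  qed simp
  from this[of "Suc n"] have "D (int n) \<le> (\<Sum>j\<le>n. npart {s+1..s+L} (int n - int j * int L)) + D (int n - int (Suc n) * int L)"
    by (simp only: lessThan_Suc_atMost)
  \<comment> \<open>After \<open>Suc n\<close> shifts by \<open>L >= 1\<close> all arguments are
    negative.\<close>
  moreover have "D (int n - int (Suc n) * int L) = 0"
  proof -
    have "n < Suc n * L" using assms(1) by (cases L) auto
    then have "int n - int (Suc n) * int L < 0" by (metis diff_less_0_iff_less of_nat_less_iff of_nat_mult)
    then show ?thesis unfolding D_def by (intro sum.neutral ballI npart_neg) linarith
  qed
  ultimately show ?thesis unfolding D_def by simp
qed

text \<open>A multiset with smallest part \<open>t\<close> and spread at most \<open>L\<close> has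
  its parts in \<open>{t..t+L}\<close> and contains \<open>t\<close>; removing one \<open>t\<close>
  turns both families of \<open>G\<close> into values of \<open>npart\<close>.\<close>

lemma G_nonneg_if:
  assumes "0 < s" "1 \<le> L"
    and le: "(\<Sum>j\<le>n. npart {s+1..s+L} (int n - int j * int L)) \<le> npart {s..s+L} (int n - int s)"
  shows "0 \<le> fps_nth (G L s) n"
proof -
  define A where "A = {M. 0 \<notin># M \<and> (M \<noteq> {#} \<and> Min (set_mset M) = s \<and>
    Max (set_mset M) - Min (set_mset M) \<le> L) \<and> sum_mset M = n}"
  define B where "B = {M. 0 \<notin># M \<and> (M \<noteq> {#} \<and> s + 1 \<le> Min (set_mset M) \<and>
    Max (set_mset M) - Min (set_mset M) \<le> L) \<and> sum_mset M = n}"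
  define C where "C t = {M \<in> msets {t..t+L} (int n). replicate_mset 1 t \<subseteq># M}" for t
  have cC: "card (C t) = npart {t..t+L} (int n - int t)" for t
    unfolding C_def using card_msets_with[of t "{t..t+L}" "int n" 1] by simp
  have G: "fps_nth (G L s) n = real (card A) - real (card B)"
    unfolding G_def size_gf_def A_def B_def
    unfolding fps_sub_nth fps_nth_Abs_fps
    by (rule arg_cong2[where f = "\<lambda>a b. real a - real b"]; rule card_partitions_mset)
       (simp_all add: smallest_part_def largest_part_def)
  have inC: "M \<in> C (Min (set_mset M))"
    if "M \<noteq> {#}" "Max (set_mset M) - Min (set_mset M) \<le> L" "sum_mset M = n" for M
  proof -
    have "x \<le> Min (set_mset M) + L" if "x \<in># M" for x
      using Max_ge[OF finite_set_mset that] \<open>Max (set_mset M) - Min (set_mset M) \<le> L\<close> by linarith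
    then show ?thesis using that Min_in[of "set_mset M"] by (auto simp: C_def msets_def)
  qed
  have "finite (C t)" if "0 < t" for t
    unfolding C_def using finite_msets[of "{t..t+L}" "int n"] that by auto
  have "C s \<subseteq> A"
  proof
    fix M assume M: "M \<in> C s"
    then have sub: "set_mset M \<subseteq> {s..s+L}" "s \<in># M" "sum_mset M = n" by (auto simp: C_def msets_def)
    then have "Min (set_mset M) = s" by (intro Min_eqI) auto
    moreover have "Max (set_mset M) \<le> s + L" using sub by (subst Max_le_iff) auto
    ultimately show "M \<in> A" using sub assms by (auto simp: A_def)
  qed
  moreover have "finite A"
    using inC by (intro finite_subset[OF _ \<open>0 < s \<Longrightarrow> finite (C s)\<close>[OF assms(1)]]) (auto simp: A_def)
  ultimately have "npart {s..s+L} (int n - int s) \<le> card A" using cC[of s] by (metis card_mono)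
  moreover have "card B \<le> (\<Sum>t\<in>{s+1..s+n}. npart {t..t+L} (int n - int t))"
  proof -
    \<comment> \<open>The smallest part is at most the sum \<open>n\<close>, so finitely many
      windows suffice.\<close>
    have "B \<subseteq> (\<Union>t\<in>{s+1..s+n}. C t)"
    proof
      fix M assume M: "M \<in> B"
      then have "Min (set_mset M) \<in># M" by (auto simp: B_def)
      then have "Min (set_mset M) \<le> n" using M
        using member_le_sum_mset by (auto simp: B_def)
      then show "M \<in> (\<Union>t\<in>{s+1..s+n}. C t)"
        using M inC[of M] by (intro UN_I[of "Min (set_mset M)"]) (auto simp: B_def)
    qed
    then have "card B \<le> card (\<Union>t\<in>{s+1..s+n}. C t)"
      using \<open>\<And>t. 0 < t \<Longrightarrow> finite (C t)\<close> by (intro card_mono) auto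
    also have "\<dots> \<le> (\<Sum>t\<in>{s+1..s+n}. card (C t))" by (rule card_UN_le) simp
    finally show ?thesis by (simp add: cC)
  qed
  ultimately show ?thesis using G le sum_npart_windows_le[of L s "s + n" n] assms by simp
qed

section \<open>Multisets with a repeated part or with many distinct parts\<close>

text \<open>If \<open>m\<close> is a multiple of \<open>s\<close>, then so are the shifts
  \<open>m * p\<close>, and the bound consists of terms that
  \<open>sum_npart_le_with_smallest\<close> accepts.\<close>

lemma npart_union_bound:
  assumes "finite S" "0 \<notin> S" "X \<subseteq> msets S k"
    and mult: "\<And>M. M \<in> X \<Longrightarrow> \<exists>p\<in>S. m \<le> count M p"
  shows "card X \<le> (\<Sum>p\<in>S. npart S (k - int m * int p))"
proof -
  have "X \<subseteq> (\<Union>p\<in>S. {M \<in> msets S k. replicate_mset m p \<subseteq># M})"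
    using assms(3) mult by (fastforce simp: count_le_replicate_mset_subset_eq)
  then have "card X \<le> card (\<Union>p\<in>S. {M \<in> msets S k. replicate_mset m p \<subseteq># M})"
    using assms finite_msets[of S k] by (intro card_mono) auto
  also have "\<dots> \<le> (\<Sum>p\<in>S. card {M \<in> msets S k. replicate_mset m p \<subseteq># M})"
    using assms(1) by (rule card_UN_le)
  finally show ?thesis by (simp add: card_msets_with)
qed

text \<open>Serves as a pigeonhole principle: a large sum forces a high multiplicity or many
  distinct parts.\<close>

lemma sum_mset_le_of_count_less:
  fixes M :: "nat multiset"
  assumes "\<And>p. p \<in># M \<Longrightarrow> count M p \<le> m"
  shows "sum_mset M \<le> m * \<Sum>(set_mset M)"
proof -
  obtain xs where xs: "M = mset xs" by (metis ex_mset)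
  have "sum_mset M = (\<Sum>p\<in>set_mset M. count M p * p)"
    using sum_list_map_eq_sum_count[of "\<lambda>x. x" xs] by (simp add: xs sum_mset_sum_list count_mset)
  also have "\<dots> \<le> (\<Sum>p\<in>set_mset M. m * p)" using assms by (intro sum_mono mult_right_mono) auto
  finally show ?thesis by (simp add: sum_distrib_left)
qed

text \<open>The number of larger elements is strictly decreasing on \<open>A\<close>, hence a
  bijection from \<open>A\<close> onto \<open>{..<card A}\<close>.\<close>

lemma card_top_elements:
  fixes A :: "nat set"
  assumes "finite A"
  shows "card {p \<in> A. card {q \<in> A. p < q} < K} = min K (card A)"
proof -
  let ?r = "\<lambda>p. card {q \<in> A. p < q}"
  have less: "?r q < ?r p" if "p \<in> A" "q \<in> A" "p < q" for p q
    using that assms by (intro psubset_card_mono) auto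
  have inj: "inj_on ?r A" by (rule inj_onI) (metis less nat_neq_iff)
  have "?r ` A \<subseteq> {..<card A}"
    using assms by (auto intro!: psubset_card_mono)
  then have img: "?r ` A = {..<card A}"
    by (intro card_subset_eq) (auto simp: card_image[OF inj])
  have "?r ` {p \<in> A. ?r p < K} = {..<min K (card A)}" proof -
    have "?r ` {p \<in> A. ?r p < K} = ?r ` A \<inter> {..<K}" by auto
    then show ?thesis unfolding img by auto
  qed
  then show ?thesis
    by (metis (no_types, lifting) card_image card_lessThan inj inj_on_subset mem_Collect_eq subsetI)
qed

(* Double counting: lower one of the t largest distinct parts p of M by t.  The lowered part is one of the
   2t largest distinct parts of the result, so that every result arises at most 2t times. *)
lemma card_many_distinct_parts_le:
  assumes S: "S = {s+1..s+L}" and X: "X \<subseteq> msets S k"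
    and many: "\<And>M. M \<in> X \<Longrightarrow> 2 * t \<le> card (set_mset M)" and "0 < t"
  shows "card X \<le> 2 * npart S (k - int t)"
proof -
  define top where "top K M = {p \<in> set_mset M. card {q \<in> set_mset M. p < q} < K}" for K and M :: "nat multiset"
  define f where "f = (\<lambda>(M, p). (M - {#p#} + {#p - t#}, p - t))"
  have fin: "finite (msets S k)" for k using finite_msets[of S k] S by simp
  have finX: "finite X" using X fin finite_subset by blast
  \<comment> \<open>At least \<open>2 * t\<close> distinct parts, fewer than \<open>t\<close> of
    them above \<open>p\<close>, leave more than \<open>t\<close> in \<open>{s+1..p}\<close>. So the
    lowered part \<open>p - t\<close> stays in the window.\<close>
  have low: "s + t < p" if "M \<in> X" "p \<in> top t M" for M p
  proof -
    have "set_mset M \<subseteq> {q \<in> set_mset M. p < q} \<union> {s+1..p}"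
      using X that S by (fastforce simp: msets_def)
    then have "card (set_mset M) \<le> card ({q \<in> set_mset M. p < q} \<union> {s+1..p})"
      by (intro card_mono) auto
    also have "\<dots> \<le> card {q \<in> set_mset M. p < q} + card {s+1..p}" by (rule card_Un_le)
    finally show ?thesis using many[of M] that by (auto simp: top_def)
  qed
  have "f ` (SIGMA M:X. top t M) \<subseteq> (SIGMA M:msets S (k - int t). top (2 * t) M)"
  proof clarify
    fix M p M' p' assume M: "M \<in> X" "p \<in> top t M" and f: "(M', p') = f (M, p)"
    have p: "p \<in># M" "card {q \<in> set_mset M. p < q} < t" using M by (auto simp: top_def)
    note lt = low[OF M]
    obtain N where N: "M = add_mset p N" using p(1) by (metis multi_member_split)
    have M': "M' = add_mset (p - t) N" "p' = p - t" using f N by (auto simp: f_def)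
    have sub: "set_mset M \<subseteq> S" "int (sum_mset M) = k" using M X by (auto simp: msets_def)
    then have "M' \<in> msets S (k - int t)" using lt S by (auto simp: msets_def N M')
    moreover have "card {q \<in> set_mset M'. p' < q} < 2 * t"
    proof -
      have "{q \<in> set_mset M'. p' < q} \<subseteq> {q \<in> set_mset M. p < q} \<union> {p - t<..p}"
        by (auto simp: M' N)
      then have "card {q \<in> set_mset M'. p' < q} \<le> card ({q \<in> set_mset M. p < q} \<union> {p - t<..p})"
        by (intro card_mono) auto
      also have "\<dots> \<le> card {q \<in> set_mset M. p < q} + card {p - t<..p}" by (rule card_Un_le)
      also have "card {p - t<..p} = t" using lt by simp
      finally show ?thesis using p by linarith
    qed
    ultimately show "M' \<in> msets S (k - int t) \<and> p' \<in> top (2 * t) M'"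
      by (auto simp: top_def M')
  qed
  \<comment> \<open>The pair records the lowered part; raising it by \<open>t\<close> recovers
    \<open>M\<close>.\<close>
  moreover have "inj_on f (SIGMA M:X. top t M)"
  proof (rule inj_onI, clarify)
    fix M p N q assume M: "M \<in> X" "p \<in> top t M" and N: "N \<in> X" "q \<in> top t N" and eq: "f (M, p) = f (N, q)"
    have "p = q" using eq low[OF M] low[OF N] by (auto simp: f_def)
    moreover have "p \<in># M" "q \<in># N" using M N by (auto simp: top_def)
    ultimately show "M = N \<and> p = q" using eq by (auto simp: f_def dest!: multi_member_split)
  qed
  moreover have "finite (SIGMA M:msets S (k - int t). top (2 * t) M)" using fin by (auto simp: top_def)
  ultimately have "card (SIGMA M:X. top t M) \<le> card (SIGMA M:msets S (k - int t). top (2 * t) M)"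
    by (metis card_inj_on_le)
  moreover have "card (SIGMA M:X. top t M) = t * card X"
  proof -
    have "card (top t M) = t" if "M \<in> X" for M
      using card_top_elements[of "set_mset M" t] many[OF that] by (simp add: top_def)
    then show ?thesis using finX by (subst card_SigmaI) (auto simp: top_def)
  qed
  moreover have "card (SIGMA M:msets S (k - int t). top (2 * t) M) \<le> t * (2 * npart S (k - int t))"
  proof -
    have "card (top (2 * t) M) \<le> 2 * t" for M
      using card_top_elements[of "set_mset M" "2 * t"] by (simp add: top_def)
    then have "(\<Sum>M\<in>msets S (k - int t). card (top (2 * t) M)) \<le> t * (2 * npart S (k - int t))"
      unfolding npart_def using sum_bounded_above[of "msets S (k - int t)" "\<lambda>M. card (top (2 * t) M)" "2 * t"]
      by (simp add: mult_ac)
    then show ?thesis using fin by (subst card_SigmaI) (auto simp: top_def)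
  qed
  ultimately have "t * card X \<le> t * (2 * npart S (k - int t))" by linarith
  then show ?thesis using \<open>0 < t\<close> by simp
qed

section \<open>The threshold and the two ranges of \<open>L\<close>\<close>

text \<open>The largest factor of the product \<open>P\<close> is \<open>4 * s + 2\<close>, and the
  power of \<open>P\<close> in \<open>gam\<close> has exponent at least 8.\<close>

lemma Gam_ge: "(4 * s + 2) ^ 5 \<le> Gam s"
proof -
  let ?L = "3 * s + 2"
  let ?P = "P ?L s"
  have "s + ?L dvd ?P" unfolding P_def by (rule dvd_prodI) auto
  moreover have "0 < ?P" unfolding P_def by (rule prod_pos) auto
  ultimately have P: "4 * s + 2 \<le> ?P" using dvd_imp_le by fastforce
  then have "2^2 \<le> ?P^2" by (intro power_mono) auto
  then have "3 * 2 \<le> (?P^2 - 1) * ?L" by (intro mult_mono) auto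
  then have "(4 * s + 2) ^ 5 \<le> ?P ^ ((?P^2 - 1) * ?L + 2)"
    using P by (intro order_trans[OF power_mono[OF P] power_increasing]) auto
  moreover have "1 \<le> (\<Sum>i=1..?L. s + i)"
    using member_le_sum[of ?L "{1..?L}" "\<lambda>i. s + i"] by simp
  ultimately show ?thesis
    unfolding Gam_def gam_def by (metis mult_le_mono nat_mult_1 trans_le_add1)
qed

(* For j >= 3 the term j is matched with the (j-2)-nd positive integer f j not divisible by s + 1.  The terms
   j < 3 are matched with multiples g (c, p) of s + 1, whose factor b ^ c makes g injective. *)
lemma sum_npart_le_of_short_window:
  assumes "0 < s" "s + 1 \<le> L" "L \<le> 3 * s" and n: "(L + 1) * Gam s \<le> n"
  shows "(\<Sum>j\<le>n. npart {s+1..s+L} (int n - int j * int L)) \<le> npart {s..s+L} (int n - int s)"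
proof -
  define S where "S = {s+1..s+L}"
  define b where "b = s + L"
  define E where "E d = npart S (int n - int d)" for d :: nat
  define f where "f j = j - 2 + (j - 3) div s" for j
  define g where "g = (\<lambda>(c, p). (s + 1) * (p * b ^ c))"
  have S: "finite S" "0 \<notin> S" by (auto simp: S_def)
  have E_mono: "E (d + d') \<le> E d" if "s + 1 \<le> d'" for d d'
    using npart_mono_add[of s L "int d'" "int n - int d"] assms(2) that
    by (simp add: E_def S_def algebra_simps)
  have E_le: "E d' \<le> E d" if "d + (s + 1) \<le> d'" for d d'
    using E_mono[of "d' - d" d] that by simp
  have E_0: "E (j * L) \<le> E 0" for j
  proof (cases j)
    case (Suc i)
    then show ?thesis using assms(2) by (intro E_le) auto
  qed simp

  \<comment> \<open>With \<open>i = j - 3\<close>, skipping the multiples of \<open>s + 1\<close>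
    adds at most \<open>i\<close> to \<open>(i + 1) * s\<close>. The gap to
    \<open>j * (s + 1)\<close> therefore exceeds the \<open>s + 1\<close> that \<open>E_le\<close>
    asks for.\<close>
  have "(\<Sum>j\<in>{3..n}. E (j * L)) \<le> (\<Sum>j\<in>{3..n}. E (f j * s))"
  proof (intro sum_mono E_le)
    fix j assume "j \<in> {3..n}"
    then obtain i where j: "j = i + 3" by (metis add.commute atLeastAtMost_iff le_Suc_ex)
    have "f j * s = s * (i + 1) + i div s * s" unfolding f_def j by (simp add: algebra_simps)
    also have "\<dots> \<le> s * (i + 1) + i" by simp
    finally have "f j * s + (s + 1) \<le> j * (s + 1)" using assms(1) by (simp add: j algebra_simps)
    also have "\<dots> \<le> j * L" using assms(2) by (intro mult_left_mono) auto
    finally show "f j * s + (s + 1) \<le> j * L" .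
  qed
  also have "\<dots> = (\<Sum>i\<in>f ` {3..n}. E (i * s))"
  proof (subst sum.reindex)
    show "inj_on f {3..n}"
    proof (rule linorder_inj_onI)
      fix x y assume "x < y" "x \<in> {3..n}" "y \<in> {3..n}"
      moreover from this have "(x - 3) div s \<le> (y - 3) div s" by (intro div_le_mono) auto
      ultimately show "f x \<noteq> f y" by (auto simp: f_def)
    qed auto
  qed simp
  finally have long: "(\<Sum>j\<in>{3..n}. E (j * L)) \<le> (\<Sum>i\<in>f ` {3..n}. E (i * s))" .

  \<comment> \<open>Here \<open>m * p = g (c, p) * s\<close>. If no part had multiplicity
    \<open>m\<close>, the sum would be at most \<open>m\<close> times the sum of \<open>S\<close>,
    which is less than \<open>n\<close>.\<close>
  have bound: "E 0 \<le> (\<Sum>p\<in>S. E (g (c, p) * s))" if "c < 3" for c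
  proof -
    define m where "m = (s + 1) * b ^ c * s"
    have "card (msets S (int n)) \<le> (\<Sum>p\<in>S. npart S (int n - int m * int p))"
    proof (rule npart_union_bound[OF S order.refl], rule ccontr)
      fix M assume M: "M \<in> msets S (int n)" and "\<not> (\<exists>p\<in>S. m \<le> count M p)"
      then have "count M p \<le> m" if "p \<in># M" for p using that by (force simp: msets_def)
      moreover have "m \<le> (s + 1) * b ^ 2 * s"
        unfolding m_def using that assms by (intro mult_mono power_increasing) (auto simp: b_def)
      ultimately have "sum_mset M \<le> (s + 1) * b ^ 2 * s * \<Sum>(set_mset M)"
        by (intro sum_mset_le_of_count_less) (meson order_trans)
      also have "\<Sum>(set_mset M) \<le> \<Sum>S" using M S by (intro sum_mono2) (auto simp: msets_def)
      also have "\<Sum>S \<le> L * b" using sum_bounded_above[of S "\<lambda>x. x" b] by (simp add: S_def b_def)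
      also have "(s + 1) * b ^ 2 * s * (L * b) = L * ((s + 1) * b ^ 3 * s)"
        by (simp add: power2_eq_square power3_eq_cube algebra_simps)
      \<comment> \<open>From \<open>L <= 3 * s\<close> follows \<open>b <= 4 * s\<close>, so each of
        the five factors is at most \<open>4 * s + 2\<close>.\<close>
      also have "\<dots> \<le> L * ((4 * s + 2) * (4 * s + 2) ^ 3 * (4 * s + 2))"
        unfolding b_def using assms(3) by (intro mult_mono power_mono) auto
      also have "\<dots> = L * (4 * s + 2) ^ 5" by (simp add: power_numeral_reduce algebra_simps)
      also have "\<dots> \<le> L * Gam s" using Gam_ge by (intro mult_left_mono) auto
      also have "\<dots> < (L + 1) * Gam s" using Gam_ge[of s] by (simp add: less_le_trans[of 0 "(4 * s + 2) ^ 5"])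
      finally show False using M n by (simp add: msets_def)
    qed
    then show ?thesis by (simp add: E_def npart_def m_def g_def algebra_simps)
  qed
  have "3 * E 0 = (\<Sum>c<3::nat. E 0)" by simp
  also have "\<dots> \<le> (\<Sum>c<3::nat. \<Sum>p\<in>S. E (g (c, p) * s))" using bound by (intro sum_mono) auto
  also have "\<dots> = (\<Sum>x\<in>{..<3} \<times> S. E (g x * s))" by (simp add: sum.cartesian_product)
  also have "\<dots> = (\<Sum>i\<in>g ` ({..<3} \<times> S). E (i * s))"
  proof (subst sum.reindex)
    \<comment> \<open>Parts exceed 1 and are at most \<open>b\<close>, so \<open>p * b ^ c\<close>
      lies above \<open>b ^ c\<close> and not above \<open>b ^ (c + 1)\<close>; these ranges are
      disjoint for different \<open>c\<close>.\<close>
    have less: "p * b ^ c < p' * b ^ c'" if "p \<in> S" "p' \<in> S" "c < c'" for p p' c c'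
    proof -
      have "p * b ^ c \<le> b ^ Suc c" using that by (simp add: S_def b_def)
      also have "\<dots> \<le> b ^ c'" using that assms(1) by (intro power_increasing) (auto simp: b_def)
      also have "\<dots> < p' * b ^ c'" using that assms(1) by (auto simp: S_def b_def)
      finally show ?thesis .
    qed
    show "inj_on g ({..<3} \<times> S)"
    proof (rule inj_onI, clarify)
      fix c p c' p' assume p: "p \<in> S" "p' \<in> S" and "g (c, p) = g (c', p')"
      then have eq: "p * b ^ c = p' * b ^ c'" by (simp only: g_def prod.case mult_cancel1) simp
      then have "c = c'" using less[OF p, of c c'] less[OF p(2,1), of c' c] by (metis nat_neq_iff less_irrefl)
      then show "c = c' \<and> p = p'" using eq assms(1) by (simp add: b_def)
    qed
  qed simp
  finally have few: "3 * E 0 \<le> (\<Sum>i\<in>g ` ({..<3} \<times> S). E (i * s))" .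

  have dvd: "(s + 1) dvd i" if "i \<in> g ` ({..<3} \<times> S)" for i
    using that by (auto simp: g_def simp del: add_mult_distrib add_mult_distrib2 mult_Suc)
  \<comment> \<open>The residue of \<open>f (k + 3)\<close> modulo \<open>s + 1\<close> is
    \<open>k mod s + 1\<close>, which lies between 1 and \<open>s\<close>.\<close>
  have ndvd: "\<not> (s + 1) dvd i" if "i \<in> f ` {3..n}" for i
  proof -
    from that obtain k where "i = f (k + 3)" by (metis add.commute atLeastAtMost_iff imageE le_Suc_ex)
    then have "i = k + 1 + k div s" by (simp add: f_def)
    also have "\<dots> = (k mod s + 1) + (s + 1) * (k div s)"
      using div_mult_mod_eq[of k s] by (simp add: algebra_simps)
    finally have "i mod (s + 1) = (k mod s + 1) mod (s + 1)" by (metis mod_mult_self2)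
    then have "i mod (s + 1) = k mod s + 1" using assms(1) by simp
    then show ?thesis by (simp add: dvd_eq_mod_eq_0)
  qed
  have "{..n} \<subseteq> {..<3} \<union> {3..n}" by auto
  then have "(\<Sum>j\<le>n. E (j * L)) \<le> (\<Sum>j\<in>{..<3} \<union> {3..n}. E (j * L))" by (intro sum_mono2) auto
  also have "\<dots> = (\<Sum>j<3. E (j * L)) + (\<Sum>j\<in>{3..n}. E (j * L))" by (rule sum.union_disjoint) auto
  also have "(\<Sum>j<3. E (j * L)) \<le> 3 * E 0" using sum_bounded_above[of "{..<3}" "\<lambda>j. E (j * L)" "E 0"] E_0 by simp
  also have "3 * E 0 + (\<Sum>j\<in>{3..n}. E (j * L)) \<le>
      (\<Sum>i\<in>g ` ({..<3} \<times> S). E (i * s)) + (\<Sum>i\<in>f ` {3..n}. E (i * s))"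
    using few long by (rule add_mono)
  also have "\<dots> = (\<Sum>i\<in>g ` ({..<3} \<times> S) \<union> f ` {3..n}. E (i * s))"
    using dvd ndvd S by (intro sum.union_disjoint[symmetric]) blast+
  also have "\<dots> = (\<Sum>i\<in>g ` ({..<3} \<times> S) \<union> f ` {3..n}. npart {s+1..s+L} (int n - int i * int s))"
    by (simp add: E_def S_def)
  also have "\<dots> \<le> npart {s..s+L} (int n - int s)"
    using S assms(1) by (intro sum_npart_le_with_smallest) (auto simp: g_def f_def b_def)
  finally show ?thesis by (simp add: E_def S_def)
qed

(* The indices i are used by residue mod 3: those congruent to 2 for the terms j >= 1, the multiples of 3 for
   the partitions of n with a part of multiplicity at least 3s, and 1 and 4 for the remaining ones. *)
lemma sum_npart_le_of_long_window:
  assumes "0 < s" "3 * s + 1 \<le> L" and n: "(L + 1) * Gam s \<le> n"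
  shows "(\<Sum>j\<le>n. npart {s+1..s+L} (int n - int j * int L)) \<le> npart {s..s+L} (int n - int s)"
proof -
  define S where "S = {s+1..s+L}"
  define E where "E d = npart S (int n - int d)" for d :: nat
  have S: "finite S" "0 \<notin> S" by (auto simp: S_def)
  have E_mono: "E (d + d') \<le> E d" if "s + 1 \<le> d'" for d d'
    using npart_mono_add[of s L "int d'" "int n - int d"] assms that
    by (simp add: E_def S_def algebra_simps)
  have E_le: "E d' \<le> E d" if "d + (s + 1) \<le> d'" for d d'
    using E_mono[of "d' - d" d] that by simp

  \<comment> \<open>As \<open>L >= 3 * s + 1\<close>, each step of \<open>j\<close> covers three
    multiples of \<open>s\<close>, of which only one is spent.\<close>
  have "(\<Sum>j\<in>{1..n}. E (j * L)) \<le> (\<Sum>j\<in>{1..n}. E ((3 * j - 1) * s))"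
  proof (intro sum_mono E_le)
    fix j assume "j \<in> {1..n}"
    then obtain i where j: "j = i + 1" by (metis add.commute atLeastAtMost_iff le_Suc_ex)
    have "(3 * j - 1) * s + (s + 1) \<le> j * (3 * s + 1)" by (simp add: j algebra_simps)
    also have "\<dots> \<le> j * L" using assms(2) by (intro mult_left_mono) auto
    finally show "(3 * j - 1) * s + (s + 1) \<le> j * L" .
  qed
  also have "\<dots> = (\<Sum>i\<in>(\<lambda>j. 3 * j - 1) ` {1..n}. E (i * s))"
    by (subst sum.reindex) (auto simp: inj_on_def)
  finally have long: "(\<Sum>j\<in>{1..n}. E (j * L)) \<le> (\<Sum>i\<in>(\<lambda>j. 3 * j - 1) ` {1..n}. E (i * s))" .

  define X where "X = {M \<in> msets S (int n). \<exists>p\<in>S. 3 * s \<le> count M p}"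
  define Y where "Y = {M \<in> msets S (int n). \<not> (\<exists>p\<in>S. 3 * s \<le> count M p)}"
  have "card X \<le> (\<Sum>p\<in>S. npart S (int n - int (3 * s) * int p))"
    by (rule npart_union_bound[OF S]) (auto simp: X_def)
  also have "\<dots> = (\<Sum>p\<in>S. E (3 * p * s))" by (simp add: E_def algebra_simps)
  also have "\<dots> = (\<Sum>i\<in>(\<lambda>p. 3 * p) ` S. E (i * s))" by (subst sum.reindex) (auto simp: inj_on_def)
  finally have X: "card X \<le> (\<Sum>i\<in>(\<lambda>p. 3 * p) ` S. E (i * s))" .

  \<comment> \<open>The number \<open>8 * s\<close> is \<open>2 * t\<close> for
    \<open>t = 4 * s\<close>, the larger of the two amounts by which parts will be lowered. With
    fewer distinct parts, each at most \<open>s + L\<close> and of multiplicity at most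
    \<open>3 * s\<close>, the sum falls short of \<open>n\<close>.\<close>
  have many: "8 * s \<le> card (set_mset M)" if M: "M \<in> Y" for M
  proof (rule ccontr)
    assume "\<not> 8 * s \<le> card (set_mset M)"
    then have small: "card (set_mset M) \<le> 8 * s" by simp
    have "count M p \<le> 3 * s" if "p \<in># M" for p using that M by (force simp: Y_def msets_def)
    then have "sum_mset M \<le> 3 * s * \<Sum>(set_mset M)" by (rule sum_mset_le_of_count_less)
    also have "\<Sum>(set_mset M) \<le> card (set_mset M) * (s + L)"
      using sum_bounded_above[of "set_mset M" "\<lambda>x. x" "s + L"] M by (force simp: Y_def msets_def S_def)
    also have "\<dots> \<le> 8 * s * (s + L)" using small by (rule mult_right_mono) simp
    also have "s + L \<le> s * (L + 1)" using assms(1) by (simp add: algebra_simps)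
    also have "3 * s * (8 * s * (s * (L + 1))) = (L + 1) * (24 * s ^ 3)"
      by (simp add: power3_eq_cube algebra_simps)
    also have "\<dots> < (L + 1) * (4 * s + 2) ^ 5"
    proof (intro mult_strict_left_mono)
      have "24 * s ^ 3 \<le> (4 * s) ^ 3" by (simp add: power_mult_distrib)
      also have "\<dots> < (4 * s + 2) ^ 3" by (intro power_strict_mono) auto
      also have "\<dots> \<le> (4 * s + 2) ^ 5" by (intro power_increasing) auto
      finally show "24 * s ^ 3 < (4 * s + 2) ^ 5" .
    qed simp
    also have "\<dots> \<le> (L + 1) * Gam s" using Gam_ge by (intro mult_left_mono) auto
    finally show False using n M by (simp add: Y_def msets_def)
  qed
  have "card Y \<le> 2 * E t" if "0 < t" "t \<le> 4 * s" for t
    unfolding E_def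
  proof (rule card_many_distinct_parts_le[OF S_def])
    show "2 * t \<le> card (set_mset M)" if "M \<in> Y" for M using many[OF that] \<open>t \<le> 4 * s\<close> by simp
  qed (use that in \<open>auto simp: Y_def\<close>)
  \<comment> \<open>Averaging the bounds for \<open>s\<close> and \<open>4 * s\<close> absorbs the
    factor 2.\<close>
  from this[of s] this[of "4 * s"] have Y: "card Y \<le> (\<Sum>i\<in>{1, 4}. E (i * s))" using assms(1) by simp
  have "E 0 = card (X \<union> Y)"
    unfolding E_def npart_def by (rule arg_cong[where f = card]) (auto simp: X_def Y_def)
  also have "\<dots> \<le> card X + card Y" by (rule card_Un_le)
  finally have first: "E 0 \<le> (\<Sum>i\<in>(\<lambda>p. 3 * p) ` S. E (i * s)) + (\<Sum>i\<in>{1, 4}. E (i * s))"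
    using X Y by linarith

  let ?I = "(\<lambda>p. 3 * p) ` S" and ?J = "(\<lambda>j. 3 * j - 1) ` {1..n}"
  have m0: "i mod 3 = 0" if "i \<in> ?I" for i using that by auto
  have m1: "i mod 3 = 1" if "i \<in> {1, 4}" for i :: nat using that by auto
  have m2: "i mod 3 = 2" if "i \<in> ?J" for i
  proof -
    from that obtain j where "1 \<le> j" "i = 3 * j - 1" by auto
    then have "i = 2 + 3 * (j - 1)" by linarith
    then show ?thesis by (simp only: mod_mult_self2) simp
  qed
  have "{..n} = insert 0 {1..n}" by auto
  then have "(\<Sum>j\<le>n. E (j * L)) = E 0 + (\<Sum>j\<in>{1..n}. E (j * L))" by simp
  also have "\<dots> \<le> (\<Sum>i\<in>?I. E (i * s)) + (\<Sum>i\<in>{1, 4}. E (i * s)) + (\<Sum>i\<in>?J. E (i * s))"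
    using first long by (rule add_mono)
  also have "(\<Sum>i\<in>?I. E (i * s)) + (\<Sum>i\<in>{1, 4}. E (i * s)) = (\<Sum>i\<in>?I \<union> {1, 4}. E (i * s))"
    using m0 m1 S by (intro sum.union_disjoint[symmetric]) fastforce+
  also have "\<dots> + (\<Sum>i\<in>?J. E (i * s)) = (\<Sum>i\<in>?I \<union> {1, 4} \<union> ?J. E (i * s))"
  proof (intro sum.union_disjoint[symmetric])
    have "i mod 3 \<noteq> 2" if "i \<in> ?I \<union> {1, 4}" for i using that m0[of i] m1[of i] by auto
    then show "(?I \<union> {1, 4}) \<inter> ?J = {}" using m2 by blast
  qed (use S in auto)
  also have "\<dots> = (\<Sum>i\<in>?I \<union> {1, 4} \<union> ?J. npart {s+1..s+L} (int n - int i * int s))"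
    by (simp add: E_def S_def)
  also have "\<dots> \<le> npart {s..s+L} (int n - int s)"
    using S assms(1) by (intro sum_npart_le_with_smallest) auto
  finally show ?thesis by (simp add: E_def S_def)
qed

theorem theorem6:
  fixes L s n :: nat
  assumes "0 < s" and "s + 1 \<le> L" and "eta3 L s \<le> real n"
  shows "0 \<le> fps_nth (G L s) n"
proof (rule G_nonneg_if)
  have "real ((L + 1) * Gam s) \<le> eta3 L s"
    unfolding eta3_def eta2_def
    by (simp only: of_nat_mult of_nat_add of_nat_1 mult_left_mono max.cobounded2 add_nonneg_nonneg of_nat_0_le_iff zero_le_one)
  then have n: "(L + 1) * Gam s \<le> n" using assms(3) by linarith
  show "(\<Sum>j\<le>n. npart {s+1..s+L} (int n - int j * int L)) \<le> npart {s..s+L} (int n - int s)"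
    \<comment> \<open>The cases \<open>L <= 3 * s\<close> and \<open>3 * s + 1 <= L\<close> are
      exhaustive.\<close>
    using sum_npart_le_of_short_window[OF assms(1,2) _ n] sum_npart_le_of_long_window[OF assms(1) _ n] by linarith
qed (use assms in auto)

end
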